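(* Let $(R,\mathfrak m)$ be an F-finite Noetherian local ring of prime characteristic $p>0$, let $x\in\mathfrak m$ be a regular element and let $t\in\mathbb R_{\geq0}$. Assume that $(R,x^t)$ is sharply F-pure. Then there exists $N\gg0$ such that $(R,(x+\delta)^t)$ is sharply F-pure for all $\delta\in\mathfrak m^N$.
   Context: A ring of characteristic $p$ is F-finite if it is a finitely generated module over itself via Frobenius. A $p^{-e}$-linear map on $R$ is an additive map $\varphi\colon R\to R$ with $\varphi(r^{p^e}s)=r\varphi(s)$ for all $r,s\in R$. For a regular element $x\in\mathfrak m$ and $t\in\mathbb R_{\geq0}$, the pair $(R,x^t)$ is sharply F-pure if for infinitely many $e\geq0$ there exists a $p^{-e}$-linear map $\varphi_e$ such that $\varphi_e\circ(x^{\lceil t(p^e-1)\rceil}F^e)=\mathrm{id}_R$, where $F$ is the Frobenius endomorphism of $R$. *)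

theory Defs
  imports Complex_Main "HOL-Computational_Algebra.Primes" "HOL-Algebra.Ideal_Product"
    "HOL-Algebra.Ring_Divisibility" "HOL-Algebra.Module"
begin

definition ring_char :: "('a, 'b) ring_scheme \<Rightarrow> nat" where
  "ring_char R = Gcd {n::nat. [n] \<cdot>\<^bsub>R\<^esub> \<one>\<^bsub>R\<^esub> = \<zero>\<^bsub>R\<^esub>}"

locale local_ring = cring R for R (structure) +
  fixes \<mm> :: "'a set"
  assumes maximal: "maximalideal \<mm> R"
    and unique_maximal: "\<And>I. maximalideal I R \<Longrightarrow> I = \<mm>"

definition regular_element :: "('a, 'b) ring_scheme \<Rightarrow> 'a \<Rightarrow> bool" where
  "regular_element R x \<longleftrightarrow>
     x \<in> carrier R \<and> (\<forall>y\<in>carrier R. x \<otimes>\<^bsub>R\<^esub> y = \<zero>\<^bsub>R\<^esub> \<longrightarrow> y = \<zero>\<^bsub>R\<^esub>)"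

definition frobenius :: "('a, 'b) ring_scheme \<Rightarrow> nat \<Rightarrow> 'a \<Rightarrow> 'a" where
  "frobenius R p r = r [^]\<^bsub>R\<^esub> p"

text \<open>The ring \<open>R\<close> as a module over itself by restriction of scalars along Frobenius.\<close>

definition frobenius_module :: "('a, 'b) ring_scheme \<Rightarrow> nat \<Rightarrow> ('a, 'a) module" where
  "frobenius_module R p =
     \<lparr>carrier = carrier R, mult = mult R, one = one R, zero = zero R, add = add R,
      smult = (\<lambda>r s. frobenius R p r \<otimes>\<^bsub>R\<^esub> s)\<rparr>"

definition finitely_generated_module ::
    "('a, 'b) ring_scheme \<Rightarrow> ('a, 'c, 'd) module_scheme \<Rightarrow> bool" where
  "finitely_generated_module R M \<longleftrightarrow>
     (\<exists>A \<subseteq> carrier M. finite A \<and>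
       (\<forall>m\<in>carrier M. \<exists>c \<in> A \<rightarrow> carrier R. m = (\<Oplus>\<^bsub>M\<^esub>a\<in>A. c a \<odot>\<^bsub>M\<^esub> a)))"

definition F_finite :: "('a, 'b) ring_scheme \<Rightarrow> nat \<Rightarrow> bool" where
  "F_finite R p \<longleftrightarrow> finitely_generated_module R (frobenius_module R p)"

text \<open>Additive maps \<open>\<phi>\<close> on \<open>R\<close> that are linear of exponent \<open>-e\<close> with respect to \<open>p\<close>.\<close>

definition p_inv_linear :: "('a, 'b) ring_scheme \<Rightarrow> nat \<Rightarrow> nat \<Rightarrow> ('a \<Rightarrow> 'a) \<Rightarrow> bool" where
  "p_inv_linear R p e \<phi> \<longleftrightarrow>
     abelian_group_hom R R \<phi> \<and>
     (\<forall>r\<in>carrier R. \<forall>s\<in>carrier R. \<phi> (r [^]\<^bsub>R\<^esub> (p ^ e) \<otimes>\<^bsub>R\<^esub> s) = r \<otimes>\<^bsub>R\<^esub> \<phi> s)"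

text \<open>
  The pair \<open>(R, x\<^sup>t)\<close> is only defined for a regular element \<open>x \<in> \<mm>\<close> and \<open>t \<ge> 0\<close>, so these
  conditions are part of the predicate: asserting it for some \<open>x\<close> includes that \<open>x\<close> is a regular
  element of \<open>\<mm>\<close>.
\<close>

definition sharply_F_pure ::
    "('a, 'b) ring_scheme \<Rightarrow> 'a set \<Rightarrow> nat \<Rightarrow> 'a \<Rightarrow> real \<Rightarrow> bool" where
  "sharply_F_pure R \<mm> p x t \<longleftrightarrow>
     x \<in> \<mm> \<and> regular_element R x \<and> 0 \<le> t \<and>
     infinite {e. \<exists>\<phi>. p_inv_linear R p e \<phi> \<and>
       (\<forall>r\<in>carrier R. \<phi> (x [^]\<^bsub>R\<^esub> nat \<lceil>t * (real (p ^ e) - 1)\<rceil> \<otimes>\<^bsub>R\<^esub> (frobenius R p ^^ e) r) = r)}"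

end

theory Submission
  imports Defs
begin

text \<open>
  Write \<open>b(e) = \<lceil>t (p\<^sup>e - 1)\<rceil>\<close>. The defining condition at level \<open>e\<close> says that some
  \<open>p\<^sup>-\<^sup>e\<close>-linear map sends \<open>x\<^sup>b\<^sup>(\<^sup>e\<^sup>)\<close> to \<open>1\<close> (\<open>splits_off\<close>). Composing such a map with itself gives
  such maps at all multiples of \<open>e\<close>, because \<open>b(e) (1 + p\<^sup>e + \<dots> + p\<^sup>(\<^sup>n\<^sup>-\<^sup>1\<^sup>)\<^sup>e)\<close> is an integer
  that is at least \<open>t (p\<^sup>n\<^sup>e - 1)\<close>. Hence sharp F-purity is witnessed by a single level \<open>e > 0\<close>
  (\<open>sharply_F_pure_iff_one_splitting\<close>), and it suffices to keep one splitting alive under the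
  perturbation.

  Fix \<open>\<phi>\<close> with \<open>\<phi>(x\<^sup>b) = 1\<close> at level \<open>e\<close>. The elements \<open>r\<close> with \<open>\<phi>(r R) \<subseteq> \<mm>\<close> form an ideal
  that contains \<open>a\<^sup>q\<close>, \<open>q = p\<^sup>e\<close>, for all \<open>a \<in> \<mm>\<close>, hence contains a power \<open>\<mm>\<^sup>N\<close> by
  Noetherianity (\<open>ideal_power_subset_if_nil_modulo\<close>). Since \<open>(x + \<delta>)\<^sup>b - x\<^sup>b\<close> is a multiple of \<open>\<delta>\<close>,
  for \<open>\<delta> \<in> \<mm>\<^sup>N\<close> the value \<open>\<phi>((x + \<delta>)\<^sup>b)\<close> lies in \<open>1 + \<mm>\<close>. It is a unit, and rescaling \<open>\<phi>\<close> gives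
  a splitting for \<open>x + \<delta>\<close> (\<open>splits_off_power_add_small\<close>).

  The element \<open>x + \<delta>\<close> must also be regular, and for \<open>t = 0\<close> no splitting forces this. There are
  finitely many nonzero \<open>y\<close> such that each zero divisor kills one of them: their annihilators are
  the maximal associated primes (\<open>finite_set_meets_annihilators\<close>). As \<open>x y \<noteq> 0\<close>, Krull's intersection theorem gives \<open>x y \<notin> \<mm>\<^sup>N\<close> for one \<open>N\<close>
  that serves all these \<open>y\<close>, so that \<open>(x + \<delta>) y = 0\<close>, that is \<open>x y = - \<delta> y\<close>, is impossible for
  \<open>\<delta> \<in> \<mm>\<^sup>N\<close> (\<open>regular_element_add_small\<close>).
\<close>

section \<open>Noetherian commutative rings\<close>

locale noetherian_cring = noetherian_ring R + cring R for R (structure)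

lemma (in noetherian_ring) exists_maximal_among_ideals:
  assumes "S \<noteq> {}" and ideals: "\<And>I. I \<in> S \<Longrightarrow> ideal I R"
  obtains M where "M \<in> S" "\<And>J. J \<in> S \<Longrightarrow> M \<subseteq> J \<Longrightarrow> J = M"
proof -
  have "\<exists>U\<in>S. \<forall>X\<in>C. X \<subseteq> U" if C: "subset.chain S C" for C
  proof (cases "C = {}")
    case True
    then show ?thesis using assms(1) by auto
  next
    case False
    have "C \<subseteq> S" using C by (simp add: subset_chain_def)
    then have "subset.chain {I. ideal I R} C"
      using C ideals by (auto simp: subset_chain_def)
    then have "\<Union>C \<in> C" using ideal_chain_is_trivial[OF False] by blast
    then show ?thesis using \<open>C \<subseteq> S\<close> by blast
  qed
  from subset_Zorn[OF this] show ?thesis using that by blast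
qed

definition colon_ideal :: "('a, 'b) ring_scheme \<Rightarrow> 'a set \<Rightarrow> 'a \<Rightarrow> 'a set" where
  "colon_ideal R J y = {a \<in> carrier R. a \<otimes>\<^bsub>R\<^esub> y \<in> J}"

context cring
begin

lemma ideal_if_closed:
  assumes "I \<subseteq> carrier R" "\<zero> \<in> I"
    and add: "\<And>a b. a \<in> I \<Longrightarrow> b \<in> I \<Longrightarrow> a \<oplus> b \<in> I"
    and mult: "\<And>a r. a \<in> I \<Longrightarrow> r \<in> carrier R \<Longrightarrow> r \<otimes> a \<in> I"
  shows "ideal I R"
proof (rule idealI)
  show "ring R" by (rule ring_axioms)
  show "subgroup I (add_monoid R)"
  proof (rule add.subgroupI)
    show "I \<noteq> {}" using assms by blast
    fix a assume a: "a \<in> I"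
    then have "(\<ominus> \<one>) \<otimes> a \<in> I" using mult by simp
    then show "\<ominus> a \<in> I" using a assms(1) by (metis l_minus l_one one_closed subsetD)
  qed (use assms in auto)
  show "a \<otimes> r \<in> I" if "a \<in> I" "r \<in> carrier R" for a r
    using mult[OF that] that assms(1) m_comm by (metis subsetD)
qed (use mult in auto)

lemma colon_ideal_is_ideal:
  assumes "ideal J R" and y: "y \<in> carrier R"
  shows "ideal (colon_ideal R J y) R"
proof -
  interpret J: ideal J R by fact
  show ?thesis
    by (rule ideal_if_closed)
      (use y in \<open>auto simp: colon_ideal_def l_distr m_assoc J.a_closed J.I_l_closed\<close>)
qed

lemma subset_colon_ideal:
  assumes "ideal J R" "y \<in> carrier R"
  shows "J \<subseteq> colon_ideal R J y"
  using assms ideal.I_r_closed ideal.Icarr by (fastforce simp: colon_ideal_def)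

lemma ideal_add_principal:
  assumes J: "ideal J R" and a: "a \<in> carrier R"
  defines "L \<equiv> {u \<oplus> r \<otimes> a | u r. u \<in> J \<and> r \<in> carrier R}"
  shows "ideal L R" "J \<subseteq> L" "a \<in> L"
proof -
  interpret J: ideal J R by fact
  show "ideal L R"
  proof (rule ideal_if_closed)
    show "L \<subseteq> carrier R" using a by (auto simp: L_def)
    show "\<zero> \<in> L" unfolding L_def using a
      by (intro CollectI exI[of _ \<zero>]) simp
    fix b r assume "b \<in> L" and r: "r \<in> carrier R"
    then obtain u s where b: "b = u \<oplus> s \<otimes> a" "u \<in> J" "s \<in> carrier R" by (auto simp: L_def)
    have "r \<otimes> b = r \<otimes> u \<oplus> (r \<otimes> s) \<otimes> a"
      using a b r by (simp add: r_distr m_assoc)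
    then show "r \<otimes> b \<in> L" unfolding L_def using b r J.I_l_closed by blast
  next
    fix b c assume "b \<in> L" "c \<in> L"
    then obtain u s v r where b: "b = u \<oplus> s \<otimes> a" "u \<in> J" "s \<in> carrier R"
      and c: "c = v \<oplus> r \<otimes> a" "v \<in> J" "r \<in> carrier R" by (auto simp: L_def)
    have "b \<oplus> c = (u \<oplus> v) \<oplus> (s \<oplus> r) \<otimes> a"
      using a b c by (simp add: l_distr a_ac)
    then show "b \<oplus> c \<in> L" unfolding L_def using b c J.a_closed by blast
  qed
  show "J \<subseteq> L"
  proof
    fix u assume "u \<in> J"
    then show "u \<in> L" unfolding L_def using a
      by (intro CollectI exI[of _ u] exI[of _ \<zero>]) simp
  qed
  show "a \<in> L" unfolding L_def using a
    by (intro CollectI exI[of _ \<zero>] exI[of _ \<one>]) simp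
qed

lemma ideal_power_ideal:
  "ideal I R \<Longrightarrow> ideal (I [^]\<^bsub>ideals_set R\<^esub> (n::nat)) R"
proof -
  interpret S: comm_monoid "ideals_set R" by (rule ideals_set_is_comm_monoid)
  show "ideal I R \<Longrightarrow> ?thesis"
    using S.nat_pow_closed[of I n] by (simp add: ideals_set_def)
qed

lemma ideal_power_one:
  "ideal I R \<Longrightarrow> I [^]\<^bsub>ideals_set R\<^esub> (1::nat) = I"
proof -
  interpret S: comm_monoid "ideals_set R" by (rule ideals_set_is_comm_monoid)
  show "ideal I R \<Longrightarrow> ?thesis"
    using S.nat_pow_eone[of I] by (simp add: ideals_set_def)
qed

lemma ideal_power_add:
  "ideal I R \<Longrightarrow> I [^]\<^bsub>ideals_set R\<^esub> (m + n :: nat)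
    = (I [^]\<^bsub>ideals_set R\<^esub> m) \<cdot> (I [^]\<^bsub>ideals_set R\<^esub> n)"
proof -
  interpret S: comm_monoid "ideals_set R" by (rule ideals_set_is_comm_monoid)
  show "ideal I R \<Longrightarrow> ?thesis"
    using S.nat_pow_mult[of I m n] by (simp add: ideals_set_def)
qed

lemma ideal_power_antimono:
  assumes "ideal I R" "m \<le> n"
  shows "I [^]\<^bsub>ideals_set R\<^esub> (n::nat) \<subseteq> I [^]\<^bsub>ideals_set R\<^esub> m"
  using ideal_power_add[OF assms(1), of m "n - m"] assms
    ideal_prod_inter[OF ideal_power_ideal[OF assms(1), of m] ideal_power_ideal[OF assms(1), of "n - m"]]
  by auto

lemma ideal_prod_subset:
  assumes "ideal J R" "\<And>i k. i \<in> I \<Longrightarrow> k \<in> K \<Longrightarrow> i \<otimes> k \<in> J"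
  shows "I \<cdot> K \<subseteq> J"
proof
  interpret J: ideal J R by fact
  fix s assume "s \<in> I \<cdot> K"
  then show "s \<in> J" by induct (auto simp: assms J.a_closed)
qed

end

context noetherian_cring
begin

text \<open>
  Noetherian induction on \<open>J\<close>: let \<open>M\<close> be a maximal counterexample, and let \<open>a \<in> I - M\<close>. Since \<open>a\<close>
  is nilpotent modulo \<open>M\<close>, it is a zero divisor modulo \<open>M\<close>, so both \<open>(M : a)\<close> and \<open>M + R a\<close> are
  strictly larger than \<open>M\<close> and contain powers of \<open>I\<close>; but \<open>(M : a) (M + R a) \<subseteq> M\<close>.
\<close>

lemma ideal_power_subset_if_nil_modulo:
  assumes I: "ideal I R" and J: "ideal J R"
    and nil: "\<And>a. a \<in> I \<Longrightarrow> \<exists>k::nat. a [^] k \<in> J"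
  shows "\<exists>n::nat. I [^]\<^bsub>ideals_set R\<^esub> n \<subseteq> J"
proof (rule ccontr)
  define S where "S = {J. ideal J R \<and> (\<forall>a\<in>I. \<exists>k::nat. a [^] k \<in> J)
      \<and> \<not> (\<exists>n::nat. I [^]\<^bsub>ideals_set R\<^esub> n \<subseteq> J)}"
  have ideals_S: "\<And>K. K \<in> S \<Longrightarrow> ideal K R" by (simp add: S_def)
  interpret I: ideal I R by fact
  assume "\<not> ?thesis"
  then have "J \<in> S" using J nil by (auto simp: S_def)
  then obtain M where "M \<in> S" and max: "\<And>K. K \<in> S \<Longrightarrow> M \<subseteq> K \<Longrightarrow> K = M"
    using exists_maximal_among_ideals[of S] ideals_S by blast
  then have M: "ideal M R" and nilM: "\<And>a. a \<in> I \<Longrightarrow> \<exists>k::nat. a [^] k \<in> M"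
    and notM: "\<And>n::nat. \<not> I [^]\<^bsub>ideals_set R\<^esub> n \<subseteq> M"
    by (auto simp: S_def)
  interpret M: ideal M R by fact
  have bigger: "\<exists>n::nat. I [^]\<^bsub>ideals_set R\<^esub> n \<subseteq> K" if "ideal K R" "M \<subset> K" for K
  proof (rule ccontr)
    assume "\<not> ?thesis"
    moreover have "\<forall>a\<in>I. \<exists>k::nat. a [^] k \<in> K"
      using nilM that(2) by (meson psubsetD)
    ultimately have "K \<in> S" using that(1) by (simp add: S_def)
    then show False using max[of K] that(2) by auto
  qed
  obtain a where a: "a \<in> I" "a \<notin> M"
    using notM[of 1] ideal_power_one[OF I] by auto
  then have ac: "a \<in> carrier R" by auto
  \<comment> \<open>The last power of \<open>a\<close> outside \<open>M\<close> shows that \<open>(M : a)\<close> is larger than \<open>M\<close>.\<close>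
  define k where "k = (LEAST k::nat. a [^] k \<in> M)"
  have k: "a [^] k \<in> M" unfolding k_def using nilM[OF a(1)] by (rule LeastI_ex)
  have "k \<noteq> 0"
    using k a ac M.I_l_closed[of \<one> a] by (intro notI) auto
  then obtain l where l: "k = Suc l" by (cases k) auto
  then have "a [^] l \<notin> M"
    using not_less_Least[of l "\<lambda>k. a [^] k \<in> M"] by (simp add: k_def[symmetric])
  moreover have "a [^] l \<in> colon_ideal R M a"
    using k l ac by (simp add: colon_ideal_def)
  ultimately have "M \<subset> colon_ideal R M a"
    using subset_colon_ideal[OF M ac] by blast
  then obtain n :: nat where n: "I [^]\<^bsub>ideals_set R\<^esub> n \<subseteq> colon_ideal R M a"
    using bigger colon_ideal_is_ideal[OF M ac] by blast
  define L where "L = {u \<oplus> r \<otimes> a | u r. u \<in> M \<and> r \<in> carrier R}"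
  have "ideal L R" "M \<subset> L"
    using ideal_add_principal[OF M ac] a(2) unfolding L_def by blast+
  then obtain m :: nat where m: "I [^]\<^bsub>ideals_set R\<^esub> m \<subseteq> L"
    using bigger by blast
  have "(I [^]\<^bsub>ideals_set R\<^esub> n) \<cdot> (I [^]\<^bsub>ideals_set R\<^esub> m) \<subseteq> M"
  proof (rule ideal_prod_subset[OF M])
    fix i j assume "i \<in> I [^]\<^bsub>ideals_set R\<^esub> n" "j \<in> I [^]\<^bsub>ideals_set R\<^esub> m"
    then have i: "i \<in> carrier R" "i \<otimes> a \<in> M" and "j \<in> L"
      using n m by (auto simp: colon_ideal_def)
    then obtain u r where j: "j = u \<oplus> r \<otimes> a" "u \<in> M" "r \<in> carrier R"
      by (auto simp: L_def)
    then have "i \<otimes> j = i \<otimes> u \<oplus> r \<otimes> (i \<otimes> a)"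
      using i ac by (simp add: r_distr m_lcomm)
    then show "i \<otimes> j \<in> M" using i j by (simp add: M.I_l_closed M.a_closed)
  qed
  then show False using notM[of "n + m"] ideal_power_add[OF I] by auto
qed

abbreviation annihilator where "annihilator y \<equiv> colon_ideal R {\<zero>} y"

lemma annihilator_eq: "annihilator y = {a \<in> carrier R. a \<otimes> y = \<zero>}"
  by (simp add: colon_ideal_def)

lemma annihilator_ideal: "y \<in> carrier R \<Longrightarrow> ideal (annihilator y) R"
  by (rule colon_ideal_is_ideal[OF zeroideal])

lemma exists_maximal_annihilator:
  assumes "w \<in> carrier R - {\<zero>}"
  obtains z where "z \<in> carrier R - {\<zero>}" "annihilator w \<subseteq> annihilator z"
    "\<And>y. y \<in> carrier R - {\<zero>} \<Longrightarrow> annihilator z \<subseteq> annihilator y \<Longrightarrow> annihilator y = annihilator z"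
proof -
  define S where "S = annihilator ` {z \<in> carrier R - {\<zero>}. annihilator w \<subseteq> annihilator z}"
  have "S \<noteq> {}" using assms by (auto simp: S_def)
  moreover have "\<And>I. I \<in> S \<Longrightarrow> ideal I R" using annihilator_ideal by (auto simp: S_def)
  ultimately obtain M where M: "M \<in> S" "\<And>J. J \<in> S \<Longrightarrow> M \<subseteq> J \<Longrightarrow> J = M"
    using exists_maximal_among_ideals[of S] by blast
  then obtain z where z: "z \<in> carrier R - {\<zero>}" "annihilator w \<subseteq> annihilator z" "M = annihilator z"
    by (auto simp: S_def)
  show ?thesis
  proof (rule that[OF z(1,2)])
    fix y assume "y \<in> carrier R - {\<zero>}" "annihilator z \<subseteq> annihilator y"
    then show "annihilator y = annihilator z" using M(2)[of "annihilator y"] z by (auto simp: S_def)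
  qed
qed

text \<open>
  Annihilators of nonzero elements that are maximal among such are prime, and every zero divisor lies
  in one of them. Let \<open>A\<close> be the set of elements with such an annihilator. Noetherianity puts \<open>A\<close>
  inside the ideal generated by some finite \<open>F \<subseteq> A\<close>. For \<open>z \<in> A\<close>, whatever kills all of \<open>F\<close> then
  kills \<open>z\<close>, so the prime \<open>ann z\<close> contains the intersection of the finitely many \<open>ann y\<close> with
  \<open>y \<in> F\<close>, hence one of them, and equals it by maximality.
\<close>

lemma finite_set_meets_annihilators:
  obtains F where "finite F" "F \<subseteq> carrier R - {\<zero>}"
    "\<And>a w. a \<in> carrier R \<Longrightarrow> w \<in> carrier R - {\<zero>} \<Longrightarrow> a \<otimes> w = \<zero> \<Longrightarrow> \<exists>y\<in>F. a \<otimes> y = \<zero>"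
proof -
  define A where "A = {z \<in> carrier R - {\<zero>}. \<forall>y \<in> carrier R - {\<zero>}.
      annihilator z \<subseteq> annihilator y \<longrightarrow> annihilator y = annihilator z}"
  have A: "A \<subseteq> carrier R - {\<zero>}" by (auto simp: A_def)
  have prime: "a \<otimes> z = \<zero>"
    if "z \<in> A" "a \<in> carrier R" "b \<in> carrier R" "a \<otimes> b \<otimes> z = \<zero>" "b \<otimes> z \<noteq> \<zero>" for a b z
  proof -
    have z: "z \<in> carrier R" using that A by auto
    have "annihilator z \<subseteq> annihilator (b \<otimes> z)"
      using that z by (auto simp: annihilator_eq m_lcomm[of _ b z])
    then have "annihilator (b \<otimes> z) = annihilator z"
      using that z by (auto simp: A_def)
    moreover have "a \<in> annihilator (b \<otimes> z)"
      using that z by (simp add: annihilator_eq m_assoc)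
    ultimately show ?thesis by (auto simp: annihilator_eq)
  qed
  define S where "S = genideal R ` {F. finite F \<and> F \<subseteq> A}"
  have "S \<noteq> {}" by (auto simp: S_def)
  moreover have "\<And>I. I \<in> S \<Longrightarrow> ideal I R"
    using A genideal_ideal by (auto simp: S_def)
  ultimately obtain M where M: "M \<in> S" "\<And>J. J \<in> S \<Longrightarrow> M \<subseteq> J \<Longrightarrow> J = M"
    using exists_maximal_among_ideals[of S] by blast
  then obtain F where F: "finite F" "F \<subseteq> A" "M = Idl F" by (auto simp: S_def)
  have A_sub: "z \<in> Idl F" if "z \<in> A" for z
  proof -
    have sub: "insert z F \<subseteq> carrier R" using that F A by auto
    have "Idl F \<subseteq> Idl (insert z F)"
      using sub genideal_self[OF sub] by (intro genideal_minimal genideal_ideal) auto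
    moreover have "Idl (insert z F) \<in> S" using that F by (auto simp: S_def)
    ultimately have "Idl (insert z F) = Idl F" using M(2) F by blast
    then show ?thesis using genideal_self[OF sub] by auto
  qed
  \<comment> \<open>The contrapositive: a prime \<open>ann z\<close> containing no \<open>ann y\<close> omits an element of
    their intersection, namely a product of elements of the \<open>ann y\<close> outside \<open>ann z\<close>.\<close>
  have avoid: "\<exists>c\<in>carrier R. c \<otimes> z \<noteq> \<zero> \<and> (\<forall>y\<in>G. c \<otimes> y = \<zero>)"
    if "finite G" "G \<subseteq> A" "z \<in> A" "\<forall>y\<in>G. \<not> annihilator y \<subseteq> annihilator z" for G z
    using that
  proof (induction G)
    case empty
    then show ?case using A by (intro bexI[of _ \<one>]) auto
  next
    case (insert g G)
    then obtain c where c: "c \<in> carrier R" "c \<otimes> z \<noteq> \<zero>" "\<forall>y\<in>G. c \<otimes> y = \<zero>" by auto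
    obtain b where b: "b \<in> carrier R" "b \<otimes> g = \<zero>" "b \<otimes> z \<noteq> \<zero>"
      using insert.prems by (auto simp: annihilator_eq)
    have sub: "insert g G \<subseteq> carrier R" "z \<in> carrier R" using insert.prems A by auto
    have "c \<otimes> b \<otimes> z \<noteq> \<zero>" using prime[of z c b] insert.prems b c by blast
    moreover have "c \<otimes> b \<otimes> g = \<zero>" using b c sub by (simp add: m_assoc)
    moreover have "c \<otimes> b \<otimes> y = \<zero>" if "y \<in> G" for y
    proof -
      have "y \<in> carrier R" using that sub by auto
      then have "c \<otimes> b \<otimes> y = b \<otimes> (c \<otimes> y)" using b c by (simp add: m_ac)
      then show ?thesis using b c that by simp
    qed
    ultimately show ?case using b c by (intro bexI[of _ "c \<otimes> b"]) auto
  qed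
  have "\<exists>y\<in>F. a \<otimes> y = \<zero>" if a: "a \<in> carrier R" and w: "w \<in> carrier R - {\<zero>}" "a \<otimes> w = \<zero>" for a w
  proof -
    obtain z where z: "z \<in> A" "annihilator w \<subseteq> annihilator z"
    proof (rule exists_maximal_annihilator[OF w(1)])
      fix z assume z: "z \<in> carrier R - {\<zero>}" "annihilator w \<subseteq> annihilator z"
        and "\<And>y. y \<in> carrier R - {\<zero>} \<Longrightarrow> annihilator z \<subseteq> annihilator y
          \<Longrightarrow> annihilator y = annihilator z"
      then have "z \<in> A" unfolding A_def by blast
      then show thesis using z(2) by (rule that)
    qed
    have "\<exists>y\<in>F. annihilator y \<subseteq> annihilator z"
    proof (rule ccontr)
      assume "\<not> ?thesis"
      then obtain c where c: "c \<in> carrier R" "c \<otimes> z \<noteq> \<zero>" "\<forall>y\<in>F. c \<otimes> y = \<zero>"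
        using avoid[OF F(1,2) z(1)] by blast
      have "F \<subseteq> carrier R" using F A by blast
      then have "F \<subseteq> annihilator c" using c(1,3) by (auto simp: annihilator_eq m_comm[of _ c])
      then have "Idl F \<subseteq> annihilator c" using c annihilator_ideal genideal_minimal by blast
      then have "z \<otimes> c = \<zero>" using A_sub z by (auto simp: annihilator_eq)
      then show False using c z A m_comm by auto
    qed
    then obtain y where y: "y \<in> F" "annihilator y \<subseteq> annihilator z" by blast
    have "y \<in> A" "z \<in> carrier R - {\<zero>}" using y z F A by blast+
    then have "annihilator z = annihilator y" using y(2) by (simp add: A_def)
    moreover have "a \<in> annihilator z" using z w a by (auto simp: annihilator_eq)
    ultimately show ?thesis using y by (auto simp: annihilator_eq)
  qed
  then show ?thesis using that F A by blast
qed

end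

section \<open>Noetherian local rings\<close>

locale noetherian_local_ring = local_ring R \<mm> + noetherian_ring R for R (structure) and \<mm>

sublocale noetherian_local_ring \<subseteq> noetherian_cring ..

context noetherian_local_ring
begin

lemma maximal_is_ideal: "ideal \<mm> R"
  using maximal by (simp add: maximalideal_def)

lemma one_notin_maximal: "\<one> \<notin> \<mm>"
  using maximal maximalideal.I_notcarr ideal.one_imp_carrier[OF maximal_is_ideal] by blast

text \<open>
  If \<open>a\<close> is not a unit, a proper ideal containing \<open>a\<close> that is maximal with this property is a maximal
  ideal, hence is \<open>\<mm>\<close>.
\<close>

lemma unit_if_notin_maximal:
  assumes a: "a \<in> carrier R" "a \<notin> \<mm>"
  shows "a \<in> Units R"
proof (rule ccontr)
  assume not_unit: "a \<notin> Units R"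
  define S where "S = {I. ideal I R \<and> a \<in> I \<and> \<one> \<notin> I}"
  have ideals_S: "\<And>I. I \<in> S \<Longrightarrow> ideal I R" by (simp add: S_def)
  have "\<one> \<notin> PIdl a"
  proof
    assume "\<one> \<in> PIdl a"
    then obtain b where "b \<in> carrier R" "\<one> = b \<otimes> a" by (auto simp: cgenideal_def)
    then have "a \<in> Units R" using a m_comm by (auto simp: Units_def)
    then show False using not_unit by simp
  qed
  then have "PIdl a \<in> S"
    using a cgenideal_ideal cgenideal_self by (auto simp: S_def)
  then obtain M where M: "M \<in> S" "\<And>J. J \<in> S \<Longrightarrow> M \<subseteq> J \<Longrightarrow> J = M"
    using exists_maximal_among_ideals[of S] ideals_S by blast
  have "maximalideal M R"
  proof (rule maximalidealI)
    show "ideal M R" "carrier R \<noteq> M" using M by (auto simp: S_def)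
    fix J assume "ideal J R" "M \<subseteq> J" "J \<subseteq> carrier R"
    then show "J = M \<or> J = carrier R"
      using M ideal.one_imp_carrier[of J R] unfolding S_def by blast
  qed
  then have "M = \<mm>" by (rule unique_maximal)
  then show False using M a by (auto simp: S_def)
qed

text \<open>
  Since \<open>1 - a\<close> is a unit for \<open>a \<in> \<mm>\<close>, \<open>z \<notin> \<mm> z\<close>. Let \<open>H \<supseteq> \<mm> z\<close> be maximal among the ideals omitting
  \<open>z\<close>. For \<open>a \<in> \<mm>\<close> the chain \<open>(H : a\<^sup>k)\<close> becomes stationary at some \<open>k\<close>. If \<open>z = u + r a\<^sup>k\<close> with
  \<open>u \<in> H\<close>, then \<open>a z \<in> H\<close> gives \<open>r a\<^sup>k\<^sup>+\<^sup>1 \<in> H\<close>, so \<open>r a\<^sup>k \<in> H\<close> and \<open>z \<in> H\<close>, a contradiction. Hence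
  \<open>H + R a\<^sup>k\<close> omits \<open>z\<close>, and maximality gives \<open>a\<^sup>k \<in> H\<close>. So \<open>\<mm>\<close> is nil modulo \<open>H\<close>, and a power of
  \<open>\<mm>\<close> is contained in \<open>H\<close> and omits \<open>z\<close>.
\<close>

lemma krull_intersection:
  assumes z: "z \<in> carrier R" "z \<noteq> \<zero>"
  shows "\<exists>n::nat. z \<notin> \<mm> [^]\<^bsub>ideals_set R\<^esub> n"
proof -
  interpret m: ideal \<mm> R by (rule maximal_is_ideal)
  define S where "S = {H. ideal H R \<and> (\<forall>a\<in>\<mm>. a \<otimes> z \<in> H) \<and> z \<notin> H}"
  have ideals_S: "\<And>I. I \<in> S \<Longrightarrow> ideal I R" by (simp add: S_def)
  define Z where "Z = {a \<otimes> z | a. a \<in> \<mm>}"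
  have "ideal Z R"
  proof (rule ideal_if_closed)
    show "Z \<subseteq> carrier R" using z by (auto simp: Z_def)
    show "\<zero> \<in> Z" unfolding Z_def using z by (intro CollectI exI[of _ \<zero>]) simp
    fix b r assume "b \<in> Z" "r \<in> carrier R"
    then obtain a where a: "a \<in> \<mm>" "b = a \<otimes> z" by (auto simp: Z_def)
    then have "r \<otimes> b = (r \<otimes> a) \<otimes> z" using z \<open>r \<in> carrier R\<close> by (simp add: m_assoc)
    then show "r \<otimes> b \<in> Z" unfolding Z_def using a \<open>r \<in> carrier R\<close> m.I_l_closed by blast
  next
    fix b c assume "b \<in> Z" "c \<in> Z"
    then obtain a a' where a: "a \<in> \<mm>" "b = a \<otimes> z" "a' \<in> \<mm>" "c = a' \<otimes> z" by (auto simp: Z_def)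
    then have "b \<oplus> c = (a \<oplus> a') \<otimes> z" using z by (simp add: l_distr)
    then show "b \<oplus> c \<in> Z" unfolding Z_def using a m.a_closed by blast
  qed
  moreover have "z \<notin> Z"
  proof
    assume "z \<in> Z"
    then obtain a where a: "a \<in> \<mm>" "z = a \<otimes> z" by (auto simp: Z_def)
    have ac: "a \<in> carrier R" using a by auto
    have "\<one> \<ominus> a \<notin> \<mm>"
    proof
      assume "\<one> \<ominus> a \<in> \<mm>"
      then have "(\<one> \<ominus> a) \<oplus> a \<in> \<mm>" using a m.a_closed by blast
      moreover have "(\<one> \<ominus> a) \<oplus> a = \<one>" using ac by algebra
      ultimately show False using one_notin_maximal by simp
    qed
    then have u: "\<one> \<ominus> a \<in> Units R" using ac unit_if_notin_maximal by simp
    have "(\<one> \<ominus> a) \<otimes> z = z \<ominus> a \<otimes> z" using ac z by algebra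
    also have "\<dots> = \<zero>" using a z by (metis r_right_minus_eq)
    finally have "z = \<zero>" using u z ac
      by (metis Units_l_cancel Units_closed r_null zero_closed)
    then show False using z by simp
  qed
  ultimately have "Z \<in> S" by (auto simp: S_def Z_def)
  then obtain H where "H \<in> S" and max: "\<And>J. J \<in> S \<Longrightarrow> H \<subseteq> J \<Longrightarrow> J = H"
    using exists_maximal_among_ideals[of S] ideals_S by blast
  then have H: "ideal H R" "\<And>a. a \<in> \<mm> \<Longrightarrow> a \<otimes> z \<in> H" "z \<notin> H" by (auto simp: S_def)
  interpret H: ideal H R by (rule H(1))
  have "\<exists>k::nat. a [^] k \<in> H" if a: "a \<in> \<mm>" for a
  proof -
    have ac: "a \<in> carrier R" using a by auto
    \<comment> \<open>A maximal member of the ascending chain is one where it is stationary.\<close>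
    define T where "T = range (\<lambda>k::nat. colon_ideal R H (a [^] k))"
    have "T \<noteq> {}" by (simp add: T_def)
    moreover have "\<And>I. I \<in> T \<Longrightarrow> ideal I R"
      using colon_ideal_is_ideal[OF H(1)] ac by (auto simp: T_def)
    ultimately obtain M where M: "M \<in> T" "\<And>J. J \<in> T \<Longrightarrow> M \<subseteq> J \<Longrightarrow> J = M"
      using exists_maximal_among_ideals[of T] by blast
    then obtain k :: nat where k: "M = colon_ideal R H (a [^] k)" by (auto simp: T_def)
    have "colon_ideal R H (a [^] k) \<subseteq> colon_ideal R H (a [^] Suc k)"
      using ac by (auto simp: colon_ideal_def m_assoc[symmetric] H.I_r_closed)
    then have stable: "colon_ideal R H (a [^] Suc k) = colon_ideal R H (a [^] k)"
      using M(2)[of "colon_ideal R H (a [^] Suc k)"] unfolding k T_def by blast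
    define L where "L = {u \<oplus> r \<otimes> (a [^] k) | u r. u \<in> H \<and> r \<in> carrier R}"
    have L: "ideal L R" "H \<subseteq> L" "a [^] k \<in> L"
      using ideal_add_principal[OF H(1), of "a [^] k"] ac unfolding L_def by auto
    have "z \<notin> L"
    proof
      assume "z \<in> L"
      then obtain u r where u: "z = u \<oplus> r \<otimes> (a [^] k)" "u \<in> H" "r \<in> carrier R"
        by (auto simp: L_def)
      define v where "v = a [^] k"
      have c: "u \<in> carrier R" "v \<in> carrier R" using u ac by (auto simp: v_def)
      have "r \<otimes> (v \<otimes> a) = a \<otimes> z \<ominus> a \<otimes> u"
        using c u ac unfolding v_def[symmetric] by algebra
      also have "\<dots> \<in> H" using H(2)[OF a] u ac H.I_l_closed
        by (simp add: a_minus_def H.a_closed)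
      finally have "r \<in> colon_ideal R H (a [^] Suc k)"
        using u by (simp add: colon_ideal_def v_def)
      then have "r \<otimes> (a [^] k) \<in> H" using stable by (auto simp: colon_ideal_def)
      then have "z \<in> H" using u H.a_closed by simp
      then show False using H by simp
    qed
    then have "L \<in> S" using L H by (auto simp: S_def)
    then have "L = H" using max L by blast
    then show ?thesis using L by auto
  qed
  then obtain n :: nat where "\<mm> [^]\<^bsub>ideals_set R\<^esub> n \<subseteq> H"
    using ideal_power_subset_if_nil_modulo[OF maximal_is_ideal H(1)] by blast
  then show ?thesis using H by blast
qed

text \<open>
  A zero divisor \<open>x + \<delta>\<close> kills one of finitely many nonzero \<open>y\<close>, and then \<open>x y = - \<delta> y\<close> is too small
  for the nonzero element \<open>x y\<close>.
\<close>

lemma regular_element_add_small: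
  assumes x: "regular_element R x"
  shows "\<exists>N::nat. \<forall>\<delta> \<in> \<mm> [^]\<^bsub>ideals_set R\<^esub> N. regular_element R (x \<oplus> \<delta>)"
proof -
  have xc: "x \<in> carrier R" using x by (simp add: regular_element_def)
  obtain F where F: "finite F" "F \<subseteq> carrier R - {\<zero>}"
    "\<And>a w. a \<in> carrier R \<Longrightarrow> w \<in> carrier R - {\<zero>} \<Longrightarrow> a \<otimes> w = \<zero> \<Longrightarrow> \<exists>y\<in>F. a \<otimes> y = \<zero>"
    using finite_set_meets_annihilators by blast
  have "\<exists>n::nat. x \<otimes> y \<notin> \<mm> [^]\<^bsub>ideals_set R\<^esub> n" if "y \<in> F" for y
    using krull_intersection[of "x \<otimes> y"] that F x by (auto simp: regular_element_def)
  then obtain n :: "'a \<Rightarrow> nat" where n: "\<And>y. y \<in> F \<Longrightarrow> x \<otimes> y \<notin> \<mm> [^]\<^bsub>ideals_set R\<^esub> n y"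
    by metis
  define N where "N = Max (insert 0 (n ` F))"
  have "regular_element R (x \<oplus> \<delta>)" if \<delta>: "\<delta> \<in> \<mm> [^]\<^bsub>ideals_set R\<^esub> N" for \<delta>
  proof -
    interpret P: ideal "\<mm> [^]\<^bsub>ideals_set R\<^esub> N" R
      by (rule ideal_power_ideal[OF maximal_is_ideal])
    have dc: "\<delta> \<in> carrier R" using \<delta> by auto
    have "w = \<zero>" if w: "w \<in> carrier R" "(x \<oplus> \<delta>) \<otimes> w = \<zero>" for w
    proof (rule ccontr)
      assume "w \<noteq> \<zero>"
      then obtain y where y: "y \<in> F" "(x \<oplus> \<delta>) \<otimes> y = \<zero>"
        using F(3)[of "x \<oplus> \<delta>" w] xc dc w by auto
      have yc: "y \<in> carrier R" using y F by auto
      have "x \<otimes> y = (x \<oplus> \<delta>) \<otimes> y \<ominus> \<delta> \<otimes> y" using xc dc yc by algebra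
      also have "\<dots> = \<ominus> (\<delta> \<otimes> y)" using y dc yc by (simp add: a_minus_def)
      also have "\<dots> \<in> \<mm> [^]\<^bsub>ideals_set R\<^esub> N" using \<delta> yc P.I_r_closed by simp
      finally have "x \<otimes> y \<in> \<mm> [^]\<^bsub>ideals_set R\<^esub> N" .
      moreover have "n y \<le> N" using F(1) y by (simp add: N_def)
      ultimately show False
        using n[OF y(1)] ideal_power_antimono[OF maximal_is_ideal] by blast
    qed
    then show ?thesis using xc dc by (simp add: regular_element_def)
  qed
  then show ?thesis by blast
qed

end

section \<open>Splittings of Frobenius\<close>

text \<open>
  In characteristic \<open>p\<close> this says that the map \<open>r \<mapsto> c r\<^sup>q\<close>, \<open>q = p\<^sup>e\<close>, from \<open>R\<close> to its restriction of
  scalars along the \<open>e\<close>-th power of Frobenius splits, that is, that \<open>c\<close> generates a free direct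
  summand there.
\<close>

definition splits_off :: "('a, 'b) ring_scheme \<Rightarrow> nat \<Rightarrow> nat \<Rightarrow> 'a \<Rightarrow> bool" where
  "splits_off R p e c \<longleftrightarrow> (\<exists>\<phi>. p_inv_linear R p e \<phi> \<and> \<phi> c = \<one>\<^bsub>R\<^esub>)"

context cring
begin

lemma p_inv_linear_iff:
  "p_inv_linear R p e \<phi> \<longleftrightarrow> \<phi> \<in> carrier R \<rightarrow> carrier R \<and>
    (\<forall>r\<in>carrier R. \<forall>s\<in>carrier R. \<phi> (r \<oplus> s) = \<phi> r \<oplus> \<phi> s) \<and>
    (\<forall>r\<in>carrier R. \<forall>s\<in>carrier R. \<phi> (r [^] (p ^ e) \<otimes> s) = r \<otimes> \<phi> s)"
proof -
  have "abelian_group_hom R R \<phi> \<longleftrightarrow> group_hom (add_monoid R) (add_monoid R) \<phi>"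
    using abelian_group_axioms by (auto intro: abelian_group_homI simp: abelian_group_hom_def abelian_group_hom_axioms_def)
  also have "\<dots> \<longleftrightarrow> \<phi> \<in> hom (add_monoid R) (add_monoid R)"
    using add.is_group by (auto simp: group_hom_def group_hom_axioms_def)
  also have "\<dots> \<longleftrightarrow> \<phi> \<in> carrier R \<rightarrow> carrier R \<and>
    (\<forall>r\<in>carrier R. \<forall>s\<in>carrier R. \<phi> (r \<oplus> s) = \<phi> r \<oplus> \<phi> s)"
    by (simp add: hom_def)
  finally show ?thesis unfolding p_inv_linear_def by blast
qed

lemma p_inv_linear_premult:
  assumes "p_inv_linear R p e \<phi>" and c: "c \<in> carrier R"
  shows "p_inv_linear R p e (\<lambda>s. \<phi> (c \<otimes> s))"
  using assms by (auto simp: p_inv_linear_iff r_distr m_lcomm[OF c])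

lemma p_inv_linear_comp:
  assumes "p_inv_linear R p e \<phi>" "p_inv_linear R p d \<psi>"
  shows "p_inv_linear R p (d + e) (\<lambda>s. \<psi> (\<phi> s))"
  unfolding p_inv_linear_iff
proof (intro conjI ballI)
  fix r s assume rs: "r \<in> carrier R" "s \<in> carrier R"
  have "r [^] p ^ (d + e) = (r [^] p ^ d) [^] p ^ e"
    using rs by (simp add: nat_pow_pow power_add)
  then show "\<psi> (\<phi> (r [^] p ^ (d + e) \<otimes> s)) = r \<otimes> \<psi> (\<phi> s)"
    using assms rs by (auto simp: p_inv_linear_iff Pi_iff)
qed (use assms in \<open>auto simp: p_inv_linear_iff Pi_iff\<close>)

lemma splits_off_iff_splitting:
  assumes c: "c \<in> carrier R"
  shows "splits_off R p e c \<longleftrightarrow>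
    (\<exists>\<phi>. p_inv_linear R p e \<phi> \<and> (\<forall>r\<in>carrier R. \<phi> (c \<otimes> (frobenius R p ^^ e) r) = r))"
proof -
  have frob: "(frobenius R p ^^ e) r = r [^] (p ^ e)" if "r \<in> carrier R" for r
    using that by (induct e) (simp_all add: frobenius_def nat_pow_pow mult.commute)
  have "\<phi> c = \<one> \<longleftrightarrow> (\<forall>r\<in>carrier R. \<phi> (c \<otimes> (frobenius R p ^^ e) r) = r)"
    if \<phi>: "p_inv_linear R p e \<phi>" for \<phi>
  proof -
    have "\<phi> (c \<otimes> (frobenius R p ^^ e) r) = r \<otimes> \<phi> c" if "r \<in> carrier R" for r
      using \<phi> that c by (simp add: frob m_comm p_inv_linear_iff)
    moreover have "\<phi> c \<in> carrier R" using \<phi> c by (auto simp: p_inv_linear_iff)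
    ultimately show ?thesis by (metis l_one r_one one_closed)
  qed
  then show ?thesis unfolding splits_off_def by blast
qed

text \<open>
  Multiplying the argument of \<open>\<phi>\<close> by a \<open>p\<^sup>e\<close>-th power \<open>v\<^sup>q\<close> multiplies its value by \<open>v\<close>, so the unit value
  can be normalized to \<open>1\<close>.
\<close>

lemma splits_off_if_unit_value:
  assumes "p_inv_linear R p e \<phi>" "c \<in> carrier R" "\<phi> c \<in> Units R"
  shows "splits_off R p e c"
proof -
  define v where "v = inv (\<phi> c)"
  have v: "v \<in> carrier R" "v \<otimes> \<phi> c = \<one>" using assms by (auto simp: v_def)
  then have "p_inv_linear R p e (\<lambda>s. \<phi> (v [^] (p ^ e) \<otimes> s))"
    using assms p_inv_linear_premult by auto
  moreover have "\<phi> (v [^] (p ^ e) \<otimes> c) = \<one>"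
    using assms v by (simp add: p_inv_linear_iff)
  ultimately show ?thesis unfolding splits_off_def by blast
qed

lemma splits_off_factor:
  assumes "splits_off R p e (c \<otimes> d)" "c \<in> carrier R"
  shows "splits_off R p e d"
  using assms p_inv_linear_premult unfolding splits_off_def by blast

text \<open>
  If \<open>\<phi>(c) = 1\<close> and \<open>\<psi>(b) = 1\<close>, then \<open>\<psi>(\<phi>(b\<^sup>q c)) = \<psi>(b \<phi>(c)) = 1\<close>.
\<close>

lemma splits_off_compose:
  assumes "splits_off R p e c" "splits_off R p d b" "c \<in> carrier R" "b \<in> carrier R"
  shows "splits_off R p (d + e) (b [^] (p ^ e) \<otimes> c)"
proof -
  obtain \<phi> \<psi> where \<phi>: "p_inv_linear R p e \<phi>" "\<phi> c = \<one>" and \<psi>: "p_inv_linear R p d \<psi>" "\<psi> b = \<one>"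
    using assms unfolding splits_off_def by blast
  have "\<psi> (\<phi> (b [^] (p ^ e) \<otimes> c)) = \<one>"
    using \<phi> \<psi> assms by (simp add: p_inv_linear_iff)
  then show ?thesis unfolding splits_off_def using p_inv_linear_comp[OF \<phi>(1) \<psi>(1)] by blast
qed

lemma splits_off_power_iterate:
  assumes x: "x \<in> carrier R" and s: "splits_off R p e (x [^] (b::nat))"
  shows "splits_off R p (n * e) (x [^] (b * (\<Sum>i<n. (p ^ e) ^ i)))"
proof (induct n)
  case 0
  have "p_inv_linear R p 0 (\<lambda>r. r)" by (auto simp: p_inv_linear_iff)
  then show ?case by (auto simp: splits_off_def)
next
  case (Suc n)
  let ?B = "b * (\<Sum>i<n. (p ^ e) ^ i)"
  have "?B * p ^ e + b = b * (\<Sum>i<Suc n. (p ^ e) ^ i)"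
    by (simp add: sum.lessThan_Suc_shift sum_distrib_left sum_distrib_right algebra_simps del: sum.lessThan_Suc)
  then show ?case
    using splits_off_compose[OF s Suc] x by (simp add: nat_pow_pow nat_pow_mult add.commute)
qed

text \<open>
  With \<open>q = p\<^sup>e\<close> and \<open>b \<ge> t (q - 1)\<close>, the exponent reached by iterating a splitting \<open>n\<close> times is
  \<open>b (1 + q + \<dots> + q\<^sup>n\<^sup>-\<^sup>1) \<ge> t (q\<^sup>n - 1)\<close>. It is an integer, so it is at least the ceiling of the right
  side, and a factor of an element that splits off splits off too. The level \<open>e = 0\<close> has to be
  excluded: its multiples are not infinitely many, and the identity is a splitting there for every
  \<open>x\<close>.
\<close>

lemma sharply_F_pure_iff_one_splitting:
  assumes "x \<in> \<mm>" and x: "regular_element R x" and "0 \<le> t" and p: "1 < p"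
  shows "sharply_F_pure R \<mm> p x t \<longleftrightarrow>
    (\<exists>e>0. splits_off R p e (x [^] nat \<lceil>t * (real (p ^ e) - 1)\<rceil>))"
proof -
  have xc: "x \<in> carrier R" using x by (simp add: regular_element_def)
  define S where "S = {e. splits_off R p e (x [^] nat \<lceil>t * (real (p ^ e) - 1)\<rceil>)}"
  have "sharply_F_pure R \<mm> p x t \<longleftrightarrow> infinite S"
    using assms xc by (simp add: sharply_F_pure_def S_def splits_off_iff_splitting)
  also have "\<dots> \<longleftrightarrow> (\<exists>e>0. e \<in> S)"
  proof
    assume "infinite S"
    then show "\<exists>e>0. e \<in> S"
      by (metis infinite_nat_iff_unbounded)
  next
    assume "\<exists>e>0. e \<in> S"
    then obtain e where e: "0 < e" "e \<in> S" by blast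
    define b where "b = nat \<lceil>t * (real (p ^ e) - 1)\<rceil>"
    have mem: "n * e \<in> S" for n
    proof -
      define B where "B = b * (\<Sum>i<n. (p ^ e) ^ i)"
      have "t * (real (p ^ e) - 1) \<le> real b"
        unfolding b_def by linarith
      then have "t * (real (p ^ e) - 1) * (\<Sum>i<n. real (p ^ e) ^ i) \<le> real b * (\<Sum>i<n. real (p ^ e) ^ i)"
        by (intro mult_right_mono sum_nonneg) auto
      moreover have "(real (p ^ e) - 1) * (\<Sum>i<n. real (p ^ e) ^ i) = real (p ^ (n * e)) - 1"
        using power_diff_1_eq[of "real (p ^ e)" n] by (simp add: power_mult mult.commute[of n])
      ultimately have "t * (real (p ^ (n * e)) - 1) \<le> real B"
        by (simp add: B_def mult.assoc)
      then have le: "nat \<lceil>t * (real (p ^ (n * e)) - 1)\<rceil> \<le> B"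
        by (simp add: nat_le_iff ceiling_le_iff)
      have "splits_off R p (n * e) (x [^] B)"
        using splits_off_power_iterate[OF xc, of p e b n] e by (simp add: S_def b_def B_def)
      then show ?thesis
        using splits_off_factor[of p "n * e"
            "x [^] (B - nat \<lceil>t * (real (p ^ (n * e)) - 1)\<rceil>)" "x [^] nat \<lceil>t * (real (p ^ (n * e)) - 1)\<rceil>"]
          le xc by (simp add: S_def nat_pow_mult)
    qed
    have "inj (\<lambda>n. n * e)" using e by (simp add: inj_on_def)
    then have "infinite (range (\<lambda>n. n * e))" using finite_imageD by blast
    then show "infinite S" using mem finite_subset[of "range (\<lambda>n. n * e)" S] by blast
  qed
  finally show ?thesis by (simp add: S_def)
qed

lemma power_add_multiple:
  assumes "x \<in> carrier R" "\<delta> \<in> carrier R"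
  shows "\<exists>s\<in>carrier R. (x \<oplus> \<delta>) [^] (n::nat) = x [^] n \<oplus> \<delta> \<otimes> s"
proof (induct n)
  case 0
  then show ?case using assms by (intro bexI[of _ \<zero>]) auto
next
  case (Suc n)
  then obtain s where s: "s \<in> carrier R" "(x \<oplus> \<delta>) [^] n = x [^] n \<oplus> \<delta> \<otimes> s" by blast
  define v where "v = x [^] n"
  have v: "v \<in> carrier R" using assms by (simp add: v_def)
  have "(x \<oplus> \<delta>) [^] Suc n = x [^] Suc n \<oplus> \<delta> \<otimes> (v \<oplus> s \<otimes> (x \<oplus> \<delta>))"
    unfolding nat_pow_Suc s(2) v_def[symmetric] using assms s(1) v by algebra
  then show ?case using assms s(1) v by (intro bexI[of _ "v \<oplus> s \<otimes> (x \<oplus> \<delta>)"]) auto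
qed

end

context noetherian_local_ring
begin

text \<open>
  The ideal \<open>J\<close> in the proof is the largest ideal that \<open>\<phi>\<close> maps into \<open>\<mm>\<close>. It contains \<open>a\<^sup>q\<close> for
  \<open>a \<in> \<mm>\<close>, because \<open>\<phi>(a\<^sup>q s) = a \<phi>(s)\<close>; hence it contains some \<open>\<mm>\<^sup>N\<close>, and changing \<open>x\<close> by an
  element of \<open>\<mm>\<^sup>N\<close> moves the value \<open>\<phi>(x\<^sup>b) = 1\<close> only within the units \<open>1 + \<mm>\<close>.
\<close>

lemma splits_off_power_add_small:
  assumes x: "x \<in> carrier R" and s: "splits_off R p e (x [^] (b::nat))"
  shows "\<exists>N::nat. \<forall>\<delta> \<in> \<mm> [^]\<^bsub>ideals_set R\<^esub> N. splits_off R p e ((x \<oplus> \<delta>) [^] b)"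
proof -
  interpret m: ideal \<mm> R by (rule maximal_is_ideal)
  obtain \<phi> where \<phi>: "p_inv_linear R p e \<phi>" "\<phi> (x [^] b) = \<one>"
    using s unfolding splits_off_def by blast
  have closed: "\<phi> r \<in> carrier R" if "r \<in> carrier R" for r
    using \<phi>(1) that by (auto simp: p_inv_linear_iff)
  have add: "\<phi> (r \<oplus> s) = \<phi> r \<oplus> \<phi> s" if "r \<in> carrier R" "s \<in> carrier R" for r s
    using \<phi>(1) that by (simp add: p_inv_linear_iff)
  have lin: "\<phi> (r [^] (p ^ e) \<otimes> s) = r \<otimes> \<phi> s" if "r \<in> carrier R" "s \<in> carrier R" for r s
    using \<phi>(1) that by (simp add: p_inv_linear_iff)
  define J where "J = {r \<in> carrier R. \<forall>s\<in>carrier R. \<phi> (r \<otimes> s) \<in> \<mm>}"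
  have "\<phi> \<zero> \<oplus> \<phi> \<zero> = \<phi> \<zero>" using add[of \<zero> \<zero>] by simp
  then have zero: "\<phi> \<zero> = \<zero>" using closed[of \<zero>] by (simp add: add.l_cancel_one)
  have J: "ideal J R"
  proof (rule ideal_if_closed)
    show "\<zero> \<in> J" by (simp add: J_def zero)
    show "a \<oplus> c \<in> J" if "a \<in> J" "c \<in> J" for a c
      using that by (auto simp: J_def l_distr add m.a_closed)
    show "r \<otimes> a \<in> J" if "a \<in> J" "r \<in> carrier R" for a r
      using that by (auto simp: J_def m_comm[of r a] m_assoc)
  qed (auto simp: J_def)
  have "a [^] (p ^ e) \<in> J" if "a \<in> \<mm>" for a
    using that by (auto simp: J_def lin closed m.I_r_closed)
  then obtain N :: nat where N: "\<mm> [^]\<^bsub>ideals_set R\<^esub> N \<subseteq> J"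
    using ideal_power_subset_if_nil_modulo[OF maximal_is_ideal J] by blast
  have "splits_off R p e ((x \<oplus> \<delta>) [^] b)" if "\<delta> \<in> \<mm> [^]\<^bsub>ideals_set R\<^esub> N" for \<delta>
  proof -
    have \<delta>: "\<delta> \<in> carrier R" "\<And>s. s \<in> carrier R \<Longrightarrow> \<phi> (\<delta> \<otimes> s) \<in> \<mm>"
      using that N by (auto simp: J_def)
    obtain s where s: "s \<in> carrier R" "(x \<oplus> \<delta>) [^] b = x [^] b \<oplus> \<delta> \<otimes> s"
      using power_add_multiple[OF x \<delta>(1)] by blast
    have val: "\<phi> ((x \<oplus> \<delta>) [^] b) = \<one> \<oplus> \<phi> (\<delta> \<otimes> s)"
      using s \<delta> x \<phi>(2) add by simp
    have "\<one> \<oplus> \<phi> (\<delta> \<otimes> s) \<notin> \<mm>"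
    proof
      assume "\<one> \<oplus> \<phi> (\<delta> \<otimes> s) \<in> \<mm>"
      then have "(\<one> \<oplus> \<phi> (\<delta> \<otimes> s)) \<oplus> \<ominus> \<phi> (\<delta> \<otimes> s) \<in> \<mm>"
        using \<delta>(2)[OF s(1)] m.a_closed m.a_inv_closed by blast
      then show False
        using one_notin_maximal s \<delta> closed by (simp add: a_assoc r_neg)
    qed
    moreover have xd: "(x \<oplus> \<delta>) [^] b \<in> carrier R" using x \<delta>(1) by simp
    ultimately have "\<phi> ((x \<oplus> \<delta>) [^] b) \<in> Units R"
      using val unit_if_notin_maximal closed[OF xd] by metis
    then show ?thesis by (rule splits_off_if_unit_value[OF \<phi>(1) xd])
  qed
  then show ?thesis by blast
qed

end

theorem proposition5p17:
  fixes R :: "('a, 'b) ring_scheme" (structure)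
    and \<mm> :: "'a set" and p :: nat and x :: 'a and t :: real
  assumes "local_ring R \<mm>" and "noetherian_ring R"
    and "Factorial_Ring.prime p" and "ring_char R = p"
    and "F_finite R p"
    and "x \<in> \<mm>" and "regular_element R x"
    and "0 \<le> t"
    and "sharply_F_pure R \<mm> p x t"
  shows "\<exists>N\<^sub>0::nat. \<forall>N\<ge>N\<^sub>0. \<forall>\<delta> \<in> \<mm> [^]\<^bsub>ideals_set R\<^esub> N. sharply_F_pure R \<mm> p (x \<oplus> \<delta>) t"
proof -
  interpret local_ring R \<mm> by fact
  interpret noetherian_ring R by fact
  interpret noetherian_local_ring R \<mm> ..
  interpret m: ideal \<mm> R by (rule maximal_is_ideal)
  have xc: "x \<in> carrier R" using assms by auto
  have p: "1 < p" using assms(3) prime_gt_1_nat by blast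
  obtain e where e: "0 < e" "splits_off R p e (x [^] nat \<lceil>t * (real (p ^ e) - 1)\<rceil>)"
    using sharply_F_pure_iff_one_splitting[OF assms(6-8) p] assms(9) by blast
  obtain N1 :: nat where N1: "\<And>\<delta>. \<delta> \<in> \<mm> [^]\<^bsub>ideals_set R\<^esub> N1 \<Longrightarrow>
      splits_off R p e ((x \<oplus> \<delta>) [^] nat \<lceil>t * (real (p ^ e) - 1)\<rceil>)"
    using splits_off_power_add_small[OF xc e(2)] by blast
  obtain N2 :: nat where N2: "\<And>\<delta>. \<delta> \<in> \<mm> [^]\<^bsub>ideals_set R\<^esub> N2 \<Longrightarrow> regular_element R (x \<oplus> \<delta>)"
    using regular_element_add_small[OF assms(7)] by blast
  \<comment> \<open>The exponent is at least \<open>1\<close> so that \<open>x + \<delta>\<close> stays in \<open>\<mm>\<close>.\<close>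
  have "sharply_F_pure R \<mm> p (x \<oplus> \<delta>) t"
    if N: "max 1 (max N1 N2) \<le> N" and \<delta>: "\<delta> \<in> \<mm> [^]\<^bsub>ideals_set R\<^esub> N" for N \<delta>
  proof -
    have "\<delta> \<in> \<mm> [^]\<^bsub>ideals_set R\<^esub> k" if "k \<le> N" for k
      using ideal_power_antimono[OF maximal_is_ideal that] \<delta> by blast
    then have \<delta>': "\<delta> \<in> \<mm>" "\<delta> \<in> \<mm> [^]\<^bsub>ideals_set R\<^esub> N1" "\<delta> \<in> \<mm> [^]\<^bsub>ideals_set R\<^esub> N2"
      using N ideal_power_one[OF maximal_is_ideal] by (metis max.bounded_iff)+
    have "x \<oplus> \<delta> \<in> \<mm>" using assms(6) \<delta>' m.a_closed by blast
    then show ?thesis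
      using sharply_F_pure_iff_one_splitting[OF _ N2[OF \<delta>'(3)] assms(8) p] e(1) N1[OF \<delta>'(2)]
      by blast
  qed
  then show ?thesis by blast
qed

end
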